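(* Let $a<b$ and $c<d$ be real numbers, $\Delta=[a,b]\times[c,d]$, $s_1,s_2\in(0,1]$, $\alpha_1,\alpha_2\in[0,1]$, $m_1,m_2\in(0,1]$, and let $q\ge1$. Let $I,J\subseteq\mathbb{R}$ be intervals with $[a,b]\subseteq I$, $[c,d]\subseteq J$, $x/m_1\in I$ for all $x\in[a,b]$ and $y/m_2\in J$ for all $y\in[c,d]$. Let $f:I\times J\to\mathbb{R}$ be a partially differentiable function whose mixed second partial derivative $f_{xy}$ exists on $I\times J$ and is integrable on $\Delta$. If $|f_{xy}|^q$ belongs to the class $K_{m,1}^{\alpha,s}(\Delta)$ (with the parameters $s_i,\alpha_i,m_i$), then $$\left|\frac{f(a,c)+f(a,d)+f(b,c)+f(b,d)}{4}+\frac{1}{(b-a)(d-c)}\int_a^b\int_c^d f(x,y)\,dy\,dx-\mathcal{A}\right|$$ $$\le\frac{(b-a)(d-c)}{4^{\frac{2q-1}{q}}}\Big[\mathcal{B}\mathcal{C}\Big\{|f_{xy}(a,c)|^q+m_1\left|f_{xy}\left(\tfrac{b}{m_1},c\right)\right|^q\Big\}+(1-\mathcal{B})(1-\mathcal{C})\Big\{m_2\left|f_{xy}\left(a,\tfrac{d}{m_2}\right)\right|^q+m_1m_2\left|f_{xy}\left(\tfrac{b}{m_1},\tfrac{d}{m_2}\right)\right|^q\Big\}\Big]^{1/q},$$ where $$\mathcal{B}=\frac{1}{2^{\alpha_1s_1}(\alpha_1s_1+1)}-\frac{1}{2^{\alpha_1s_1}(\alpha_1s_1+2)}+\frac{2}{\alpha_1s_1+2}-\frac{1}{\alpha_1s_1+1},$$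 $$\mathcal{C}=\frac{1}{2^{\alpha_2s_2}(\alpha_2s_2+1)}-\frac{1}{2^{\alpha_2s_2}(\alpha_2s_2+2)}+\frac{2}{\alpha_2s_2+2}-\frac{1}{\alpha_2s_2+1}.$$
   Context: Notation: $f_{xy}=\frac{\partial^2 f}{\partial x\,\partial y}$ is the mixed second partial derivative of $f$ in its two variables, and $$\mathcal{A}=\frac12\left[\frac{1}{b-a}\int_a^b\big(f(x,c)+f(x,d)\big)\,dx+\frac{1}{d-c}\int_c^d\big(f(a,y)+f(b,y)\big)\,dy\right].$$ Class $K_{m,1}^{\alpha,s}(\Delta)$ (co-ordinated $s$-$(\alpha,m)$-convex functions in the first sense): a real function $g$ on $I\times J$ belongs to it if for all $x,z\in[a,b]$, $y,w\in[c,d]$ and $\lambda,\mu\in[0,1]$, $$g(\lambda x+(1-\lambda)z,\ \mu y+(1-\mu)w)\le \lambda^{\alpha_1s_1}\mu^{\alpha_2s_2}g(x,y)+m_2\lambda^{\alpha_1s_1}(1-\mu^{\alpha_2s_2})\,g\left(x,\tfrac{w}{m_2}\right)$$ $$+m_1\mu^{\alpha_2s_2}(1-\lambda^{\alpha_1s_1})\,g\left(\tfrac{z}{m_1},y\right)+m_1m_2(1-\lambda^{\alpha_1s_1})(1-\mu^{\alpha_2s_2})\,g\left(\tfrac{z}{m_1},\tfrac{w}{m_2}\right).$$ *)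

theory Defs
  imports "HOL-Analysis.Analysis"
begin

text \<open>
  Real power with the convention \<open>0\<^sup>0 = 1\<close>. Plain \<open>powr\<close> gives \<open>0 powr 0 = 0\<close>, which would be
  wrong in the convexity inequality below when \<open>\<alpha>\<^sub>i = 0\<close> and a weight \<open>u\<close> or \<open>v\<close> vanishes.
\<close>
definition rpow :: "real \<Rightarrow> real \<Rightarrow> real" where
  "rpow x p = (if p = 0 then 1 else x powr p)"

text \<open>
  Co-ordinated \<open>s\<close>-\<open>(\<alpha>,m)\<close>-convex functions in the first sense on \<open>[a,b] \<times> [c,d]\<close>. A function
  defined on \<open>I \<times> J\<close> is represented by a total function; if \<open>I \<times> J\<close> contains \<open>[a,b] \<times> [c,d]\<close> and
  all points \<open>z/m\<^sub>1\<close>, \<open>w/m\<^sub>2\<close> (\<open>z \<in> [a,b]\<close>, \<open>w \<in> [c,d]\<close>) lie in \<open>I\<close>, \<open>J\<close> respectively, then membership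
  depends only on the values on \<open>I \<times> J\<close>.
\<close>
definition K_class ::
  "real \<Rightarrow> real \<Rightarrow> real \<Rightarrow> real \<Rightarrow> real \<Rightarrow> real \<Rightarrow> real \<Rightarrow> real \<Rightarrow> real \<Rightarrow> real
    \<Rightarrow> (real \<Rightarrow> real \<Rightarrow> real) set" where
  "K_class \<alpha>\<^sub>1 \<alpha>\<^sub>2 s\<^sub>1 s\<^sub>2 m\<^sub>1 m\<^sub>2 a b c d =
    {g. \<forall>x\<in>{a..b}. \<forall>z\<in>{a..b}. \<forall>y\<in>{c..d}. \<forall>w\<in>{c..d}. \<forall>u\<in>{0..1}. \<forall>v\<in>{0..1}.
      g (u * x + (1 - u) * z) (v * y + (1 - v) * w)
        \<le> rpow u (\<alpha>\<^sub>1 * s\<^sub>1) * rpow v (\<alpha>\<^sub>2 * s\<^sub>2) * g x y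
          + m\<^sub>2 * rpow u (\<alpha>\<^sub>1 * s\<^sub>1) * (1 - rpow v (\<alpha>\<^sub>2 * s\<^sub>2)) * g x (w / m\<^sub>2)
          + m\<^sub>1 * rpow v (\<alpha>\<^sub>2 * s\<^sub>2) * (1 - rpow u (\<alpha>\<^sub>1 * s\<^sub>1)) * g (z / m\<^sub>1) y
          + m\<^sub>1 * m\<^sub>2 * (1 - rpow u (\<alpha>\<^sub>1 * s\<^sub>1)) * (1 - rpow v (\<alpha>\<^sub>2 * s\<^sub>2)) * g (z / m\<^sub>1) (w / m\<^sub>2)}"

definition boundary_mean ::
  "real \<Rightarrow> real \<Rightarrow> real \<Rightarrow> real \<Rightarrow> (real \<Rightarrow> real \<Rightarrow> real) \<Rightarrow> real" where
  "boundary_mean a b c d f =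
    1 / 2 * (1 / (b - a) * integral {a..b} (\<lambda>x. f x c + f x d)
           + 1 / (d - c) * integral {c..d} (\<lambda>y. f a y + f b y))"

text \<open>The constants \<open>\<B>\<close> and \<open>\<C>\<close> are the values at \<open>p = \<alpha>\<^sub>1 s\<^sub>1\<close> and \<open>p = \<alpha>\<^sub>2 s\<^sub>2\<close>.\<close>
definition hh_coeff :: "real \<Rightarrow> real" where
  "hh_coeff p =
    1 / (2 powr p * (p + 1)) - 1 / (2 powr p * (p + 2)) + 2 / (p + 2) - 1 / (p + 1)"

end

theory Submission
  imports Defs
begin

text \<open>
  In one variable, integrating \<open>(x - (a + b) / 2) * h' x\<close> by parts gives \<open>b - a\<close> times the
  error of the trapezoid rule, the endpoint average of \<open>h\<close> minus its mean value. The quantity to be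
  estimated is the composition of these two error functionals, one in each variable, applied to
  \<open>f\<close>. So \<open>(b - a) * (d - c)\<close> times it is the double integral of
  \<open>(x - (a + b) / 2) * (y - (c + d) / 2) * f\<^sub>x\<^sub>y x y\<close> (\<open>trapezoid_defect_identity\<close>).

  The mixed derivative need not be continuous, so the order of integration has to be handled with
  care. Generalized \<open>(\<alpha>,m)\<close>-convexity makes \<open>f\<^sub>x\<^sub>y\<close> bounded on the rectangle, while \<open>f\<^sub>y a\<close> is only
  a derivative and may fail to be Lebesgue integrable. Only increments in \<open>x\<close> of the \<open>y\<close>-moment of
  \<open>f\<^sub>y\<close> are therefore exchanged with integrals (\<open>Fubini_rectangle\<close>). They show that the moment is an
  indefinite integral of a bounded function, and the second integration by parts is done for
  such primitives (\<open>integral_moment_eq_primitive\<close>).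

  For the estimate, let \<open>\<phi>\<close> and \<open>\<psi>\<close> be the powers of the barycentric coordinates of \<open>x\<close> and \<open>y\<close>
  in the convexity inequality. That inequality, between the corners, bounds \<open>\<bar>f\<^sub>x\<^sub>y x y\<bar> powr q\<close> by a
  combination of the products of \<open>\<phi>\<close> or \<open>1 - \<phi>\<close> with \<open>\<psi>\<close> or \<open>1 - \<psi>\<close>. The tangent to the concave
  function \<open>R \<mapsto> R powr (1 / q)\<close> turns this into a bound for \<open>\<bar>f\<^sub>x\<^sub>y x y\<bar>\<close> that is affine in these
  products; this takes the place of the power mean inequality. With respect to the weight
  \<open>\<bar>x - (a + b) / 2\<bar>\<close>, of total mass \<open>(b - a)\<^sup>2 / 4\<close>, the functions \<open>\<phi>\<close> and \<open>1 - \<phi>\<close> integrate to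
  \<open>(b - a)\<^sup>2 / 2\<close> times \<open>B\<close> and \<open>1 / 2 - B\<close>. Hence the proof yields the four corner coefficients
  \<open>B * C\<close>, \<open>B * (1 / 2 - C)\<close>, \<open>(1 / 2 - B) * C\<close> and \<open>(1 / 2 - B) * (1 / 2 - C)\<close>. As \<open>B\<close> and \<open>C\<close> lie
  between \<open>1 / 4\<close> and \<open>1 / 2\<close>, each is at most the coefficient of the same corner in the theorem; for
  the corner \<open>(b / m\<^sub>1, c)\<close> this is exactly the inequality \<open>1 / 4 \<le> B\<close>.
\<close>

section \<open>Fubini's theorem for gauge integrals on a rectangle\<close>

text \<open>
  The iterated gauge integral does not notice changes on sets whose almost every section is null,
  so it can be computed from a Borel representative.
\<close>
lemma has_integral_iterated_of_AE_eq:
  fixes h :: "real \<Rightarrow> real \<Rightarrow> real" and k :: "real \<times> real \<Rightarrow> real"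
  assumes k: "integrable (lborel \<Otimes>\<^sub>M lborel) k"
    and eq: "AE x in lborel. AE y in lborel. h x y = k (x, y)"
  shows "((\<lambda>x. integral UNIV (h x)) has_integral integral\<^sup>L (lborel \<Otimes>\<^sub>M lborel) k) UNIV"
proof -
  have "AE x in lborel. integral UNIV (h x) = (\<integral>y. k (x, y) \<partial>lborel)"
    using lborel_pair.AE_integrable_fst'[OF k] eq
  proof eventually_elim
    case (elim x)
    have "((\<lambda>y. k (x, y)) has_integral (\<integral>y. k (x, y) \<partial>lborel)) UNIV"
      using elim(1) by (rule has_integral_integral_lborel)
    moreover have "AE y in lborel. y \<in> UNIV \<longrightarrow> h x y = k (x, y)"
      using elim(2) by simp
    ultimately have "(h x has_integral (\<integral>y. k (x, y) \<partial>lborel)) UNIV"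
      using has_integral_AE[of UNIV "h x" "\<lambda>y. k (x, y)"] by simp
    then show ?case by (rule integral_unique)
  qed
  then have ae: "AE x in lborel. x \<in> UNIV \<longrightarrow> integral UNIV (h x) = (\<integral>y. k (x, y) \<partial>lborel)"
    by simp
  have "((\<lambda>x. \<integral>y. k (x, y) \<partial>lborel) has_integral
          (\<integral>x. (\<integral>y. k (x, y) \<partial>lborel) \<partial>lborel)) UNIV"
    using lborel_pair.integrable_fst'[OF k] by (rule has_integral_integral_lborel)
  then show ?thesis
    using has_integral_AE[OF ae] lborel_pair.integral_fst'[OF k] by simp
qed

text \<open>
  Absolute integrability is with respect to the completed Lebesgue measure on the plane, which is
  not a product measure. Fubini's theorem is applied to a Borel function equal to \<open>h\<close> almost
  everywhere. Exceptional sections may fail to be integrable; there the integral takes its default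
  value \<open>0\<close>, without effect on the outer integral.
\<close>
lemma Fubini_rectangle:
  fixes h :: "real \<Rightarrow> real \<Rightarrow> real"
  assumes h: "(\<lambda>(x, y). h x y) absolutely_integrable_on {a..b} \<times> {c..d}"
  shows "(\<lambda>x. integral {c..d} (h x)) integrable_on {a..b}"
    and "integral {c..d} (\<lambda>y. integral {a..b} (\<lambda>x. h x y))
          = integral {a..b} (\<lambda>x. integral {c..d} (h x))"
proof -
  define h0 where "h0 x y = indicator ({a..b} \<times> {c..d}) (x, y) * h x y" for x y
  have int: "integrable lebesgue (\<lambda>z. h0 (fst z) (snd z))"
    using h by (simp add: set_integrable_def h0_def case_prod_unfold)
  obtain k where k[measurable]: "k \<in> borel_measurable lborel"
    and ae: "AE z in lborel. h0 (fst z) (snd z) = k z"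
    using completion_ex_borel_measurable_real[OF borel_measurable_integrable[OF int]] by auto
  have "integrable lebesgue k"
    by (rule integrable_cong_AE_imp[OF int measurable_completion[OF k]]) (use AE_completion[OF ae] in auto)
  then have k_int: "integrable (lborel \<Otimes>\<^sub>M lborel) k"
    using integrable_completion[OF k] by (simp add: lborel_prod)
  have ae': "AE z in lborel \<Otimes>\<^sub>M lborel. h0 (fst z) (snd z) = k z"
    unfolding lborel_prod by (rule ae)
  have ae1: "AE x in lborel. AE y in lborel. h0 x y = k (x, y)"
    using lborel_pair.AE_pair[OF ae'] by simp
  have ae2: "AE y in lborel. AE x in lborel. h0 x y = k (x, y)"
  proof -
    \<comment> \<open>Exchanging the two quantifiers needs a measurable exceptional set.\<close>
    obtain N where N0: "\<And>z. z \<in> space (lborel \<Otimes>\<^sub>M lborel) - N \<Longrightarrow> h0 (fst z) (snd z) = k z"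
      "N \<in> null_sets (lborel \<Otimes>\<^sub>M lborel)"
      using AE_E3[OF ae'] by blast
    have N: "N \<in> sets (lborel \<Otimes>\<^sub>M lborel)" "AE z in lborel \<Otimes>\<^sub>M lborel. z \<notin> N"
      "\<And>z. z \<notin> N \<Longrightarrow> h0 (fst z) (snd z) = k z"
      using N0 AE_not_in[OF N0(2)] by (auto simp: space_pair_measure null_sets_def)
    have "{z \<in> space (lborel \<Otimes>\<^sub>M lborel). (fst z, snd z) \<notin> N} \<in> sets (lborel \<Otimes>\<^sub>M lborel)"
      using sets.compl_sets[OF N(1)] unfolding prod.collapse set_diff_eq .
    then have "AE y in lborel. AE x in lborel. (x, y) \<notin> N"
      using lborel_pair.AE_commute[of "\<lambda>x y. (x, y) \<notin> N"] lborel_pair.AE_pair[OF N(2)] by simp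
    then show ?thesis
      using N(3) by (elim eventually_mono) fastforce
  qed
  have sw: "integrable (lborel \<Otimes>\<^sub>M lborel) (\<lambda>(y, x). k (x, y))"
    using lborel_pair.integrable_product_swap[OF k_int] .
  have sw_eq: "integral\<^sup>L (lborel \<Otimes>\<^sub>M lborel) (\<lambda>(y, x). k (x, y)) = integral\<^sup>L (lborel \<Otimes>\<^sub>M lborel) k"
    using lborel_pair.integral_product_swap[of k] k_int by blast
  let ?v = "integral\<^sup>L (lborel \<Otimes>\<^sub>M lborel) k"
  have 1: "((\<lambda>x. integral UNIV (h0 x)) has_integral ?v) UNIV"
    by (rule has_integral_iterated_of_AE_eq[OF k_int ae1])
  have 2: "((\<lambda>y. integral UNIV (\<lambda>x. h0 x y)) has_integral ?v) UNIV"
    using has_integral_iterated_of_AE_eq[OF sw, of "\<lambda>y x. h0 x y"] ae2 sw_eq by simp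
  have e1: "integral UNIV (h0 x) = (if x \<in> {a..b} then integral {c..d} (h x) else 0)" for x
  proof -
    have "h0 x = (\<lambda>y. if y \<in> {c..d} then (if x \<in> {a..b} then h x y else 0) else 0)"
      by (auto simp: h0_def fun_eq_iff indicator_def)
    then show ?thesis
      using integral_restrict_UNIV[of "{c..d}" "\<lambda>y. if x \<in> {a..b} then h x y else 0"] by auto
  qed
  have e2: "integral UNIV (\<lambda>x. h0 x y) = (if y \<in> {c..d} then integral {a..b} (\<lambda>x. h x y) else 0)" for y
  proof -
    have "(\<lambda>x. h0 x y) = (\<lambda>x. if x \<in> {a..b} then (if y \<in> {c..d} then h x y else 0) else 0)"
      by (auto simp: h0_def fun_eq_iff indicator_def)
    then show ?thesis
      using integral_restrict_UNIV[of "{a..b}" "\<lambda>x. if y \<in> {c..d} then h x y else 0"] by auto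
  qed
  have 3: "((\<lambda>x. integral {c..d} (h x)) has_integral ?v) {a..b}"
    using 1 unfolding e1 has_integral_restrict_UNIV .
  have 4: "((\<lambda>y. integral {a..b} (\<lambda>x. h x y)) has_integral ?v) {c..d}"
    using 2 unfolding e2 has_integral_restrict_UNIV .
  show "(\<lambda>x. integral {c..d} (h x)) integrable_on {a..b}" using 3 by blast
  show "integral {c..d} (\<lambda>y. integral {a..b} (\<lambda>x. h x y))
          = integral {a..b} (\<lambda>x. integral {c..d} (h x))"
    using 3 4 by (simp add: integral_unique)
qed

section \<open>A tangent form of the power mean inequality\<close>

text \<open>
  The right-hand side, with \<open>R\<close> as the variable, is the tangent at \<open>K\<close> to the concave function
  \<open>R \<mapsto> R powr (1 / q)\<close>. Being affine in \<open>R\<close>, it can be integrated against any weight: with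
  \<open>K\<close> the weighted mean of \<open>R\<close> the last term disappears and the power mean inequality results.
\<close>
lemma powr_tangent_bound:
  fixes t q K R :: real
  assumes "q \<ge> 1" "K > 0" "t \<ge> 0" "t powr q \<le> R"
  shows "t \<le> K powr (1 / q) + K powr (1 / q - 1) / q * (R - K)"
proof -
  have bernoulli: "(R / K) powr (1 / q) \<le> 1 + (R / K - 1) / q"
  proof (cases "R = 0")
    case True then show ?thesis using assms(1) by simp
  next
    case False
    then have R: "R > 0" using assms(4) powr_ge_zero[of t q] by linarith
    have "(R / K) powr (1 / q) * 1 powr (1 - 1 / q) \<le> 1 / q * (R / K) + (1 - 1 / q) * 1"
      using assms R by (intro Youngs_inequality_0) auto
    then show ?thesis using assms(1) by (simp add: field_simps)
  qed
  have "t \<le> R powr (1 / q)"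
  proof -
    have "t = (t powr q) powr (1 / q)" using assms by (simp add: powr_powr)
    also have "\<dots> \<le> R powr (1 / q)" using assms by (intro powr_mono2) auto
    finally show ?thesis .
  qed
  also have "R powr (1 / q) = K powr (1 / q) * (R / K) powr (1 / q)"
    using assms order_trans[OF powr_ge_zero assms(4)] by (simp add: powr_divide)
  also have "K powr (1 / q) * (R / K) powr (1 / q) \<le> K powr (1 / q) * (1 + (R / K - 1) / q)"
    using bernoulli by (rule mult_left_mono) simp
  also have "K powr (1 / q) * (1 + (R / K - 1) / q) = K powr (1 / q) + K powr (1 / q - 1) / q * (R - K)"
  proof -
    have "K powr (1 / q - 1) = K powr (1 / q) / K"
      using assms by (simp add: powr_diff)
    then show ?thesis
      using assms by (simp add: field_simps)
  qed
  finally show ?thesis .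
qed

section \<open>Integrals of powers against the midpoint weight\<close>

lemma rpow_pos: "u > 0 \<Longrightarrow> rpow u p = u powr p"
  by (simp add: rpow_def)

lemma rpow_antimono:
  assumes "0 \<le> u" "u \<le> 1" "0 \<le> p" "p \<le> p'"
  shows "rpow u p' \<le> rpow u p"
proof (cases "u = 0")
  case True then show ?thesis using assms by (auto simp: rpow_def)
next
  case False
  then show ?thesis using assms by (simp add: rpow_pos powr_mono')
qed

lemma rpow_bounds:
  assumes "0 \<le> u" "u \<le> 1" "0 \<le> p"
  shows "0 \<le> rpow u p" "rpow u p \<le> 1"
  using assms rpow_antimono[of u 0 p] by (auto simp: rpow_def)

text \<open>
  This is where the constant \<open>hh_coeff p\<close> comes from. In the coordinate \<open>u = (b - x) / (b - a)\<close> the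
  integrand is \<open>(b - a) * \<bar>u - 1 / 2\<bar> * u powr p\<close>, which has an elementary primitive on each side of
  the midpoint.
\<close>
lemma has_integral_rpow_weighted:
  fixes a b p :: real
  assumes ab: "a < b" and p: "p \<ge> 0"
  shows "((\<lambda>x. \<bar>x - (a + b) / 2\<bar> * rpow ((b - x) / (b - a)) p) has_integral
           (b - a)\<^sup>2 / 2 * hh_coeff p) {a..b}"
proof -
  define m where "m = (a + b) / 2"
  define u where "u x = (b - x) / (b - a)" for x
  define T where "T x = (b - a)\<^sup>2 * (u x powr (p + 1) / (2 * (p + 1)) - u x powr (p + 2) / (p + 2))" for x
  have m: "a < m" "m < b" using ab by (auto simp: m_def)
  have u0: "u a = 1" "u b = 0" "u m = 1 / 2"
    using ab by (auto simp: u_def m_def divide_simps)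
  \<comment> \<open>Continuity up to \<open>x = b\<close>, where \<open>u x = 0\<close>, relies on the exponents being positive.\<close>
  have cont: "continuous_on {a..b} T"
  proof -
    have cu: "continuous_on {a..b} u"
      unfolding u_def using ab by (intro continuous_intros) auto
    have "continuous_on {a..b} (\<lambda>x. u x powr r)" if "r > 0" for r
      by (rule continuous_on_powr'[OF cu continuous_on_const]) (use ab that in \<open>auto simp: u_def\<close>)
    then show ?thesis
      unfolding T_def using p
      by (intro continuous_on_mult_left continuous_on_diff continuous_on_divide continuous_on_const) auto
  qed
  have deriv: "(T has_real_derivative (m - x) * rpow (u x) p) (at x)" if x: "x \<in> {a<..<b}" for x
  proof -
    have ux: "u x > 0" using x ab by (simp add: u_def)
    have du: "(u has_real_derivative - 1 / (b - a)) (at x)"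
      unfolding u_def using ab by (auto intro!: derivative_eq_intros simp: divide_simps)
    have mx: "m - x = (b - a) * (u x - 1 / 2)"
      using ab by (simp add: m_def u_def field_simps)
    have pw: "u x powr (p + 1) = u x * u x powr p" using ux by (simp add: powr_add)
    have p1: "((\<lambda>x. u x powr (p + 1)) has_real_derivative (p + 1) * u x powr p * (- 1 / (b - a))) (at x)"
      using DERIV_fun_powr[OF du ux, of "p + 1"] by simp
    have p2: "((\<lambda>x. u x powr (p + 2)) has_real_derivative (p + 2) * u x powr (p + 1) * (- 1 / (b - a))) (at x)"
      using DERIV_fun_powr[OF du ux, of "p + 2"] by (simp add: add.commute)
    have "(T has_real_derivative (b - a)\<^sup>2 * ((p + 1) * u x powr p * (- 1 / (b - a)) / (2 * (p + 1))
            - (p + 2) * u x powr (p + 1) * (- 1 / (b - a)) / (p + 2))) (at x)"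
      unfolding T_def by (intro DERIV_cmult DERIV_diff DERIV_cdivide p1 p2)
    also have "(b - a)\<^sup>2 * ((p + 1) * u x powr p * (- 1 / (b - a)) / (2 * (p + 1))
            - (p + 2) * u x powr (p + 1) * (- 1 / (b - a)) / (p + 2)) = (m - x) * rpow (u x) p"
    proof -
      have "L\<^sup>2 * (N * P * (- 1 / L) / (2 * N) - N' * (v * P) * (- 1 / L) / N') = L * (v - 1 / 2) * P"
        if "L > 0" "N > 0" "N' > 0" for L N N' P v :: real
      proof -
        have "N * P * (- 1 / L) / (2 * N) = - P / (2 * L)" "N' * (v * P) * (- 1 / L) / N' = - (v * P) / L"
          using that by simp_all
        then show ?thesis
          using that by (simp add: power2_eq_square right_diff_distrib left_diff_distrib)
      qed
      from this[of "b - a" "p + 1" "p + 2" "u x powr p" "u x"] show ?thesis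
        using p ab unfolding mx pw rpow_pos[OF ux] by simp
    qed
    finally show ?thesis .
  qed
  have 1: "((\<lambda>x. \<bar>x - m\<bar> * rpow (u x) p) has_integral (T m - T a)) {a..m}"
  proof -
    have "((\<lambda>x. (m - x) * rpow (u x) p) has_integral (T m - T a)) {a..m}"
      using m deriv
      by (intro fundamental_theorem_of_calculus_interior continuous_on_subset[OF cont])
         (auto simp: has_real_derivative_iff_has_vector_derivative)
    then show ?thesis by (rule has_integral_eq[rotated]) (auto simp: m_def)
  qed
  have 2: "((\<lambda>x. \<bar>x - m\<bar> * rpow (u x) p) has_integral - (T b - T m)) {m..b}"
  proof -
    have "((\<lambda>x. (m - x) * rpow (u x) p) has_integral (T b - T m)) {m..b}"
      using m deriv
      by (intro fundamental_theorem_of_calculus_interior continuous_on_subset[OF cont])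
         (auto simp: has_real_derivative_iff_has_vector_derivative)
    then have "((\<lambda>x. - ((m - x) * rpow (u x) p)) has_integral - (T b - T m)) {m..b}"
      by (rule has_integral_neg)
    then show ?thesis by (rule has_integral_eq[rotated]) (auto simp: algebra_simps)
  qed
  have "((\<lambda>x. \<bar>x - m\<bar> * rpow (u x) p) has_integral (T m - T a) + - (T b - T m)) {a..b}"
    using m by (intro has_integral_combine[OF _ _ 1 2]) auto
  moreover have "(T m - T a) + - (T b - T m) = (b - a)\<^sup>2 / 2 * hh_coeff p"
  proof -
    have h: "(1 / 2) powr (p + 1) = 1 / (2 * 2 powr p)" "(1 / 2) powr (p + 2) = 1 / (4 * 2 powr p)"
      by (simp_all add: powr_add powr_divide)
    define P where "P = (2::real) powr p"
    have P: "P > 0" by (simp add: P_def)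
    have "(T m - T a) + - (T b - T m) = (b - a)\<^sup>2 * (2 * (1 / (2 * P) / (2 * (p + 1)) - 1 / (4 * P) / (p + 2))
       - (1 / (2 * (p + 1)) - 1 / (p + 2)))"
      using p unfolding T_def u0 h P_def by (simp add: algebra_simps)
    also have "2 * (1 / (2 * P) / (2 * (p + 1)) - 1 / (4 * P) / (p + 2)) - (1 / (2 * (p + 1)) - 1 / (p + 2))
       = hh_coeff p / 2"
    proof -
      have "2 * (1 / (2 * P) / (2 * N) - 1 / (4 * P) / N') - (1 / (2 * N) - 1 / N')
          = (1 / (P * N) - 1 / (P * N') + 2 / N' - 1 / N) / 2" for N N' :: real
        by (simp add: add_divide_distrib diff_divide_distrib mult.commute)
      from this[of "p + 1" "p + 2"] show ?thesis
        unfolding hh_coeff_def P_def by simp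
    qed
    finally show ?thesis by simp
  qed
  ultimately show ?thesis by (simp only: m_def u_def)
qed

lemma hh_coeff_0: "hh_coeff 0 = 1 / 2"
  by (simp add: hh_coeff_def)

text \<open>
  By the integral representation on the unit interval: \<open>rpow u p\<close> decreases in \<open>p\<close>.
\<close>
lemma hh_coeff_antimono:
  assumes "0 \<le> p" "p \<le> p'"
  shows "hh_coeff p' \<le> hh_coeff p"
proof -
  note I = has_integral_rpow_weighted[of 0 "1::real"]
  have "(1 - 0)\<^sup>2 / 2 * hh_coeff p' \<le> (1 - 0)\<^sup>2 / 2 * hh_coeff p"
    using assms by (intro has_integral_le[OF I[of p'] I[of p]] mult_left_mono rpow_antimono) auto
  then show ?thesis by simp
qed

lemma hh_coeff_bounds:
  assumes "0 \<le> p" "p \<le> 1"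
  shows "1 / 4 \<le> hh_coeff p" "hh_coeff p \<le> 1 / 2"
  using hh_coeff_antimono[of p 1] hh_coeff_antimono[of 0 p] assms
  by (simp_all add: hh_coeff_0) (simp add: hh_coeff_def)

lemma has_integral_rpow_affine_weighted:
  fixes a b p :: real
  assumes "a < b" "p \<ge> 0"
  shows "((\<lambda>x. \<bar>x - (a + b) / 2\<bar> * (\<alpha> + \<beta> * rpow ((b - x) / (b - a)) p)) has_integral
           (b - a)\<^sup>2 / 2 * (\<alpha> / 2 + \<beta> * hh_coeff p)) {a..b}"
proof -
  have "((\<lambda>x. \<bar>x - (a + b) / 2\<bar>) has_integral (b - a)\<^sup>2 / 2 * (1 / 2)) {a..b}"
    using has_integral_rpow_weighted[of a b 0] assms by (simp add: rpow_def hh_coeff_0)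
  from has_integral_add[OF has_integral_mult_right[OF this, of \<alpha>]
      has_integral_mult_right[OF has_integral_rpow_weighted[OF assms], of \<beta>]]
  show ?thesis by (simp add: algebra_simps add_divide_distrib)
qed

section \<open>Integration by parts and the trapezoid defect\<close>

text \<open>
  Integration by parts for a primitive \<open>U\<close> of a bounded integrable function \<open>w\<close>, which need not be
  differentiable everywhere. The difference \<open>V\<close> of the two sides over \<open>{a..x}\<close>, as a function of
  the endpoint \<open>x\<close>, is constant because its increments are quadratic: \<open>V y - V x\<close> is the integral
  over \<open>{x..y}\<close> of a function of size at most \<open>2 * M * (y - x)\<close>.
\<close>
lemma integral_moment_eq_primitive:
  fixes w :: "real \<Rightarrow> real"
  assumes ab: "a \<le> b" and w: "w integrable_on {a..b}"
    and M: "\<And>x. x \<in> {a..b} \<Longrightarrow> \<bar>w x\<bar> \<le> M"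
  defines "U \<equiv> \<lambda>x. integral {a..x} w"
  shows "(\<lambda>x. (x - \<mu>) * w x) integrable_on {a..b}" (is ?int)
    and "integral {a..b} (\<lambda>x. (x - \<mu>) * w x) = (b - \<mu>) * U b - integral {a..b} U" (is ?eq)
proof -
  have w_abs: "w absolutely_integrable_on {a..b}"
    using w M by (intro absolutely_integrable_integrable_bound[where g = "\<lambda>_. M"]) auto
  have int: "(\<lambda>x. (x - \<nu>) * w x) integrable_on {a..b}" for \<nu>
  proof -
    have "(\<lambda>x. (x - \<nu>) * w x) absolutely_integrable_on {a..b}"
      by (intro absolutely_integrable_bounded_measurable_product_real[OF _ _ _ w_abs]
            continuous_imp_measurable_on_sets_lebesgue compact_imp_bounded
            compact_continuous_image continuous_intros) auto
    then show ?thesis by (rule set_lebesgue_integral_eq_integral)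
  qed
  then show ?int .
  have U_cont: "continuous_on {a..b} U"
    unfolding U_def by (rule indefinite_integral_continuous_1[OF w])
  then have U_int: "U integrable_on {a..b}"
    by (rule integrable_continuous_interval)
  define V where "V x = integral {a..x} (\<lambda>s. (s - \<mu>) * w s) - (x - \<mu>) * U x + integral {a..x} U" for x
  have U_diff: "U y - U x = integral {x..y} w" if "a \<le> x" "x \<le> y" "y \<le> b" for x y
    using Henstock_Kurzweil_Integration.integral_combine[of a x y w] integrable_on_subinterval[OF w, of a y] that
    by (simp add: U_def)
  have V_diff: "\<bar>V y - V x\<bar> \<le> 2 * M * (y - x)\<^sup>2" if xy: "a \<le> x" "x \<le> y" "y \<le> b" for x y
  proof -
    have sub: "{x..y} \<subseteq> {a..b}" "{a..y} \<subseteq> {a..b}" using xy by auto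
    note I = integrable_on_subinterval[OF _ sub(1)]
    note J = integrable_on_subinterval[OF _ sub(2)]
    have M0: "M \<ge> 0" using M[of x] xy by fastforce
    have U_shift: "(\<lambda>s. U s - U y) integrable_on {x..y}"
      using I[OF U_int] integrable_const_ivl by (rule Henstock_Kurzweil_Integration.integrable_diff)
    have U_le: "\<bar>U y - U s\<bar> \<le> M * (y - x)" if "s \<in> {x..y}" for s
    proof -
      have "norm (integral {s..y} w) \<le> M * (y - s)"
      proof -
        have "norm (integral {s..y} w) \<le> integral {s..y} (\<lambda>_. M)"
          using that xy M
          by (intro Henstock_Kurzweil_Integration.integral_norm_bound_integral integrable_on_subinterval[OF w]) auto
        then show ?thesis using that by (simp add: mult.commute[of M])
      qed
      moreover have "M * (y - s) \<le> M * (y - x)"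
        using M0 that by (intro mult_left_mono) auto
      ultimately show ?thesis using U_diff[of s y] that xy by simp
    qed
    have "V y - V x = integral {x..y} (\<lambda>s. (s - \<mu>) * w s) - (y - \<mu>) * U y + (x - \<mu>) * U x
        + integral {x..y} U"
      using Henstock_Kurzweil_Integration.integral_combine[of a x y "\<lambda>s. (s - \<mu>) * w s"] Henstock_Kurzweil_Integration.integral_combine[of a x y U] xy
        J[OF int[of \<mu>]] J[OF U_int] by (simp add: V_def)
    \<comment> \<open>Recentring both integrals at the ends of \<open>{x..y}\<close> makes the first-order terms cancel.\<close>
    also have "integral {x..y} (\<lambda>s. (s - \<mu>) * w s)
        = integral {x..y} (\<lambda>s. (s - x) * w s) + (x - \<mu>) * (U y - U x)"
    proof -
      have "integral {x..y} (\<lambda>s. (s - x) * w s + (x - \<mu>) * w s)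
          = integral {x..y} (\<lambda>s. (s - x) * w s) + (x - \<mu>) * integral {x..y} w"
        using I[OF int[of x]] I[OF w]
        by (simp add: Henstock_Kurzweil_Integration.integral_add integrable_on_mult_right)
      then show ?thesis by (simp add: U_diff[OF xy] algebra_simps)
    qed
    also have "integral {x..y} U = integral {x..y} (\<lambda>s. U s - U y) + (y - x) * U y"
      using I[OF U_int] xy by (subst Henstock_Kurzweil_Integration.integral_diff) auto
    finally have "V y - V x = integral {x..y} (\<lambda>s. (s - x) * w s) + integral {x..y} (\<lambda>s. U s - U y)"
      by (simp add: algebra_simps)
    also have "\<dots> = integral {x..y} (\<lambda>s. (s - x) * w s + (U s - U y))"
      by (rule Henstock_Kurzweil_Integration.integral_add[OF I[OF int[of x]] U_shift, symmetric])
    finally have V_eq: "V y - V x = integral {x..y} (\<lambda>s. (s - x) * w s + (U s - U y))" .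
    have "norm (V y - V x) \<le> integral {x..y} (\<lambda>_. 2 * M * (y - x))"
      unfolding V_eq
    proof (rule Henstock_Kurzweil_Integration.integral_norm_bound_integral)
      show "(\<lambda>s. (s - x) * w s + (U s - U y)) integrable_on {x..y}"
        by (rule Henstock_Kurzweil_Integration.integrable_add[OF I[OF int[of x]] U_shift])
      show "norm ((s - x) * w s + (U s - U y)) \<le> 2 * M * (y - x)" if s: "s \<in> {x..y}" for s
      proof -
        have "\<bar>(s - x) * w s\<bar> \<le> (y - x) * M"
          unfolding abs_mult using s xy M[of s] M0 by (intro mult_mono) auto
        moreover have "\<bar>U s - U y\<bar> \<le> (y - x) * M"
          using U_le[OF s] by (simp only: abs_minus_commute[of "U s"] mult.commute[of "y - x"])
        ultimately show ?thesis
          using abs_triangle_ineq[of "(s - x) * w s" "U s - U y"]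
          unfolding real_norm_def mult_2 distrib_right mult.commute[of "y - x" M] by linarith
      qed
    qed auto
    then show ?thesis using xy by (simp add: power2_eq_square mult.assoc mult.left_commute)
  qed
  have "(V has_field_derivative 0) (at x within {a..b})" if x: "x \<in> {a..b}" for x
  proof -
    have bound: "norm ((V y - V x) / (y - x)) \<le> 2 * M * \<bar>y - x\<bar>" if y: "y \<in> {a..b}" "y \<noteq> x" for y
    proof -
      have "\<bar>V y - V x\<bar> \<le> 2 * M * (y - x)\<^sup>2"
        using V_diff[of x y] V_diff[of y x] x y
        by (cases "x \<le> y") (simp_all only: abs_minus_commute power2_commute, auto)
      also have "\<dots> = 2 * M * \<bar>y - x\<bar> * \<bar>y - x\<bar>"
        by (simp add: power2_eq_square)
      finally have "\<bar>V y - V x\<bar> \<le> 2 * M * \<bar>y - x\<bar> * \<bar>y - x\<bar>" .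
      then show ?thesis using y by (simp add: pos_divide_le_eq)
    qed
    have "((\<lambda>y. 2 * M * \<bar>y - x\<bar>) \<longlongrightarrow> 2 * M * \<bar>x - x\<bar>) (at x within {a..b})"
      by (intro tendsto_intros)
    then have "((\<lambda>y. (V y - V x) / (y - x)) \<longlongrightarrow> 0) (at x within {a..b})"
    proof (rule Lim_null_comparison[rotated, OF tendsto_eq_rhs])
      show "\<forall>\<^sub>F y in at x within {a..b}. norm ((V y - V x) / (y - x)) \<le> 2 * M * \<bar>y - x\<bar>"
        using bound by (simp only: eventually_at_filter) (rule eventuallyI, blast)
    qed simp
    then show ?thesis by (simp add: has_field_derivative_iff)
  qed
  then obtain C where "\<And>x. x \<in> {a..b} \<Longrightarrow> V x = C"
    using has_field_derivative_zero_constant[of "{a..b}" V] by auto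
  then have "V b = V a" using ab by simp
  then show ?eq by (simp add: V_def U_def)
qed

text \<open>
  The product rule for \<open>(x - (a + b) / 2) * h x\<close>. The gauge integral integrates every derivative,
  so nothing is required of \<open>h'\<close>.
\<close>
lemma has_integral_trapezoid:
  fixes h h' :: "real \<Rightarrow> real"
  assumes ab: "a \<le> b"
    and h: "\<And>x. x \<in> {a..b} \<Longrightarrow> (h has_real_derivative h' x) (at x within {a..b})"
  shows "((\<lambda>x. (x - (a + b) / 2) * h' x) has_integral (b - a) / 2 * (h a + h b) - integral {a..b} h) {a..b}"
proof -
  have "((\<lambda>x. h x + (x - (a + b) / 2) * h' x) has_integral
          (b - (a + b) / 2) * h b - (a - (a + b) / 2) * h a) {a..b}"
    using ab
    by (intro fundamental_theorem_of_calculus)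
       (auto intro!: derivative_eq_intros h simp flip: has_real_derivative_iff_has_vector_derivative)
  moreover have "(h has_integral integral {a..b} h) {a..b}"
    by (intro integrable_integral integrable_continuous_interval DERIV_continuous_on[OF h])
  ultimately have "((\<lambda>x. (h x + (x - (a + b) / 2) * h' x) - h x) has_integral
          ((b - (a + b) / 2) * h b - (a - (a + b) / 2) * h a) - integral {a..b} h) {a..b}"
    by (rule has_integral_diff)
  then show ?thesis
    by (simp add: algebra_simps add_divide_distrib diff_divide_distrib)
qed

text \<open>
  Let \<open>W x\<close> be \<open>d - c\<close> times the trapezoid error of \<open>f x\<close> in the second variable; it is the moment
  of \<open>f\<^sub>y x\<close> about the midpoint. Its increment from \<open>a\<close> to \<open>x\<close> only involves \<open>f\<^sub>y x y - f\<^sub>y a y\<close>, an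
  integral of \<open>f\<^sub>x\<^sub>y\<close>, so by Fubini's theorem \<open>W\<close> is a primitive of \<open>w\<close> up to a constant. The left-hand
  side is \<open>b - a\<close> times the trapezoid error of \<open>W\<close> in the first variable.
\<close>
lemma trapezoid_defect_identity:
  fixes f f\<^sub>y f\<^sub>x\<^sub>y :: "real \<Rightarrow> real \<Rightarrow> real"
  assumes ab: "a < b" and cd: "c < d"
    and cont_x: "\<And>y. y \<in> {c..d} \<Longrightarrow> continuous_on {a..b} (\<lambda>x. f x y)"
    and fy: "\<And>x y. x \<in> {a..b} \<Longrightarrow> y \<in> {c..d} \<Longrightarrow> (f x has_real_derivative f\<^sub>y x y) (at y within {c..d})"
    and fxy: "\<And>x y. x \<in> {a..b} \<Longrightarrow> y \<in> {c..d} \<Longrightarrow>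
           ((\<lambda>t. f\<^sub>y t y) has_real_derivative f\<^sub>x\<^sub>y x y) (at x within {a..b})"
    and int: "(\<lambda>(x, y). f\<^sub>x\<^sub>y x y) absolutely_integrable_on {a..b} \<times> {c..d}"
    and M: "\<And>x y. x \<in> {a..b} \<Longrightarrow> y \<in> {c..d} \<Longrightarrow> \<bar>f\<^sub>x\<^sub>y x y\<bar> \<le> M"
  defines "w \<equiv> \<lambda>x. integral {c..d} (\<lambda>y. (y - (c + d) / 2) * f\<^sub>x\<^sub>y x y)"
  shows "(\<lambda>x. (x - (a + b) / 2) * w x) integrable_on {a..b}"
    and "(b - a) * (d - c) * ((f a c + f a d + f b c + f b d) / 4
          + 1 / ((b - a) * (d - c)) * integral {a..b} (\<lambda>x. integral {c..d} (\<lambda>y. f x y))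
          - boundary_mean a b c d f) = integral {a..b} (\<lambda>x. (x - (a + b) / 2) * w x)"
proof -
  define \<nu> where "\<nu> = (c + d) / 2"
  define W where "W x = (d - c) / 2 * (f x c + f x d) - integral {c..d} (f x)" for x
  have abs: "(\<lambda>(x, y). (y - \<nu>) * f\<^sub>x\<^sub>y x y) absolutely_integrable_on {a..b} \<times> {c..d}"
  proof -
    have "(\<lambda>z. (snd z - \<nu>) * (case z of (x, y) \<Rightarrow> f\<^sub>x\<^sub>y x y)) absolutely_integrable_on {a..b} \<times> {c..d}"
      by (intro absolutely_integrable_bounded_measurable_product[OF bilinear_times _ _ _ int]
            continuous_imp_measurable_on_sets_lebesgue compact_imp_bounded
            compact_continuous_image continuous_intros compact_Times) (auto intro: lmeasurable_compact compact_Times fmeasurableD)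
    then show ?thesis by (simp add: case_prod_unfold)
  qed
  have M0: "M \<ge> 0" using M[of a c] ab cd by fastforce
  have W_inc: "W x - W a = integral {a..x} w" if x: "x \<in> {a..b}" for x
  proof -
    have W_has: "((\<lambda>y. (y - \<nu>) * f\<^sub>y t y) has_integral W t) {c..d}" if "t \<in> {a..b}" for t
      unfolding W_def \<nu>_def using cd fy that by (intro has_integral_trapezoid) auto
    have "W x - W a = integral {c..d} (\<lambda>y. (y - \<nu>) * f\<^sub>y x y - (y - \<nu>) * f\<^sub>y a y)"
      using has_integral_diff[OF W_has[OF x] W_has[of a]] ab by (simp add: integral_unique)
    also have "\<dots> = integral {c..d} (\<lambda>y. integral {a..x} (\<lambda>t. (y - \<nu>) * f\<^sub>x\<^sub>y t y))"
    proof (rule integral_cong)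
      fix y assume y: "y \<in> {c..d}"
      have "((\<lambda>t. f\<^sub>x\<^sub>y t y) has_integral (f\<^sub>y x y - f\<^sub>y a y)) {a..x}"
        using x y
        by (intro fundamental_theorem_of_calculus)
           (auto simp flip: has_real_derivative_iff_has_vector_derivative intro: DERIV_subset[OF fxy])
      then have "((\<lambda>t. (y - \<nu>) * f\<^sub>x\<^sub>y t y) has_integral (y - \<nu>) * (f\<^sub>y x y - f\<^sub>y a y)) {a..x}"
        by (rule has_integral_mult_right)
      then show "(y - \<nu>) * f\<^sub>y x y - (y - \<nu>) * f\<^sub>y a y = integral {a..x} (\<lambda>t. (y - \<nu>) * f\<^sub>x\<^sub>y t y)"
        by (simp only: integral_unique right_diff_distrib)
    qed
    also have "\<dots> = integral {a..x} (\<lambda>t. integral {c..d} (\<lambda>y. (y - \<nu>) * f\<^sub>x\<^sub>y t y))"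
    proof (rule Fubini_rectangle(2))
      show "(\<lambda>(t, y). (y - \<nu>) * f\<^sub>x\<^sub>y t y) absolutely_integrable_on {a..x} \<times> {c..d}"
        using abs by (rule set_integrable_subset) (use x in \<open>auto intro: lmeasurable_compact compact_Times fmeasurableD\<close>)
    qed
    finally show ?thesis by (simp add: w_def \<nu>_def)
  qed
  have w_int: "w integrable_on {a..b}"
    using Fubini_rectangle(1)[OF abs] by (simp add: w_def \<nu>_def)
  \<comment> \<open>A section that is not integrable gives \<open>w x = 0\<close>, so the bound holds at every point.\<close>
  have w_bound: "\<bar>w x\<bar> \<le> (d - c) * M * (d - c)" if x: "x \<in> {a..b}" for x
  proof (cases "(\<lambda>y. (y - \<nu>) * f\<^sub>x\<^sub>y x y) integrable_on {c..d}")
    case True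
    have "norm (integral {c..d} (\<lambda>y. (y - \<nu>) * f\<^sub>x\<^sub>y x y)) \<le> integral {c..d} (\<lambda>_. (d - c) * M)"
    proof (rule Henstock_Kurzweil_Integration.integral_norm_bound_integral[OF True])
      show "norm ((y - \<nu>) * f\<^sub>x\<^sub>y x y) \<le> (d - c) * M" if "y \<in> {c..d}" for y
        unfolding real_norm_def abs_mult
        using that M[OF x that] cd by (intro mult_mono) (auto simp: \<nu>_def abs_if field_simps)
    qed auto
    moreover have "integral {c..d} (\<lambda>_. (d - c) * M) = (d - c) * M * (d - c)"
      using cd by simp
    ultimately show ?thesis
      by (simp only: w_def \<nu>_def real_norm_def)
  next
    case False
    then have "w x = 0" by (simp add: w_def \<nu>_def not_integrable_integral)
    then show ?thesis using M0 cd by simp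
  qed
  define U where "U = (\<lambda>x. integral {a..x} w)"
  note moment = integral_moment_eq_primitive[OF less_imp_le[OF ab] w_int w_bound, of "(a + b) / 2"]
  show "(\<lambda>x. (x - (a + b) / 2) * w x) integrable_on {a..b}"
    by (rule moment(1))
  have U_int: "U integrable_on {a..b}"
    unfolding U_def by (intro integrable_continuous_interval indefinite_integral_continuous_1 w_int)
  have W_eq: "W x = W a + U x" if "x \<in> {a..b}" for x
    using W_inc[OF that] by (simp add: U_def)
  have mean: "integral {a..b} (\<lambda>x. integral {c..d} (f x))
     = (d - c) / 2 * integral {a..b} (\<lambda>x. f x c + f x d) - (b - a) * W a - integral {a..b} U"
  proof -
    have e: "(\<lambda>x. f x c + f x d) integrable_on {a..b}"
      using cd by (intro integrable_continuous_interval continuous_intros cont_x) auto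
    have "integral {a..b} (\<lambda>x. integral {c..d} (f x))
      = integral {a..b} (\<lambda>x. (d - c) / 2 * (f x c + f x d) - (W a + U x))"
      by (intro integral_cong) (simp only: W_eq[symmetric], simp add: W_def)
    also have "\<dots> = (d - c) / 2 * integral {a..b} (\<lambda>x. f x c + f x d) - integral {a..b} (\<lambda>x. W a + U x)"
      using e U_int by (subst Henstock_Kurzweil_Integration.integral_diff) (auto intro!: integrable_add integrable_on_mult_right)
    also have "integral {a..b} (\<lambda>x. W a + U x) = (b - a) * W a + integral {a..b} U"
      using U_int ab by (subst Henstock_Kurzweil_Integration.integral_add) auto
    finally show ?thesis by simp
  qed
  have bd: "integral {c..d} (\<lambda>y. f a y + f b y) = integral {c..d} (f a) + integral {c..d} (f b)"
    using ab by (intro Henstock_Kurzweil_Integration.integral_add integrable_continuous_interval DERIV_continuous_on[OF fy]) auto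
  have "integral {a..b} (\<lambda>x. (x - (a + b) / 2) * w x) = (b - a) / 2 * (W a + W b) - ((b - a) * W a + integral {a..b} U)"
  proof -
    have "integral {a..b} (\<lambda>x. (x - (a + b) / 2) * w x) = (b - (a + b) / 2) * U b - integral {a..b} U"
      using moment(2) by (simp only: U_def)
    then show ?thesis
      using W_eq[of b] ab by (simp add: field_simps)
  qed
  also have "\<dots> = (b - a) * (d - c) * ((f a c + f a d + f b c + f b d) / 4
          + 1 / ((b - a) * (d - c)) * integral {a..b} (\<lambda>x. integral {c..d} (f x))
          - boundary_mean a b c d f)"
  proof -
    \<comment> \<open>The remaining step is an identity of rational functions of the two side lengths \<open>X\<close> and \<open>Y\<close>.\<close>
    have key: "X / 2 * (Wa + Wb) - (X * Wa + iU)
        = X * Y * (s / 4 + 1 / (X * Y) * (Y / 2 * j - X * Wa - iU) - 1 / 2 * (1 / X * j + 1 / Y * (ia + ib)))"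
      if XY: "X > 0" "Y > 0" and W: "Wa = Y / 2 * (s1 + s2) - ia" "Wb = Y / 2 * (s3 + s4) - ib"
        and s: "s = s1 + s2 + s3 + s4"
      for X Y Wa Wb iU j ia ib s s1 s2 s3 s4 :: real
    proof -
      have "X * Y * (s / 4 + 1 / (X * Y) * i - 1 / 2 * (1 / X * j + 1 / Y * (ia + ib)))
          = X * Y * s / 4 + i - (Y * j + X * (ia + ib)) / 2" for i
        using XY by (simp add: field_simps)
      note e1 = this[of "Y / 2 * j - X * Wa - iU"]
      have e2: "X * Y * s / 4 + (Y / 2 * j - X * Wa - iU) - (Y * j + X * (ia + ib)) / 2
          = X / 2 * (Wa + Wb) - (X * Wa + iU)"
        unfolding W s by (simp add: algebra_simps add_divide_distrib)
      show ?thesis by (simp only: e1 e2)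
    qed
    show ?thesis
      unfolding boundary_mean_def bd mean
      by (rule key) (use ab cd in \<open>auto simp: W_def\<close>)
  qed
  finally show "(b - a) * (d - c) * ((f a c + f a d + f b c + f b d) / 4
          + 1 / ((b - a) * (d - c)) * integral {a..b} (\<lambda>x. integral {c..d} (\<lambda>y. f x y))
          - boundary_mean a b c d f) = integral {a..b} (\<lambda>x. (x - (a + b) / 2) * w x)" by simp
qed

section \<open>The weighted estimate\<close>

text \<open>
  The majorant of \<open>\<bar>g x y\<bar>\<close> is affine in \<open>\<psi> y\<close> for fixed \<open>x\<close>, and its weighted integral over \<open>y\<close> is
  again affine in \<open>\<phi> x\<close>. So the one-variable formula applies twice and the majorant is integrated
  exactly. Bounding the inner integral for every \<open>x\<close> in this way avoids any integrability
  of \<open>\<bar>g\<bar>\<close> itself.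
\<close>
lemma iterated_midpoint_moment_bound:
  fixes g :: "real \<Rightarrow> real \<Rightarrow> real"
  assumes ab: "a < b" and cd: "c < d" and p: "0 \<le> p\<^sub>1" "0 \<le> p\<^sub>2"
  defines "\<phi> \<equiv> \<lambda>x. rpow ((b - x) / (b - a)) p\<^sub>1"
    and "\<psi> \<equiv> \<lambda>y. rpow ((d - y) / (d - c)) p\<^sub>2"
    and "w \<equiv> \<lambda>x. integral {c..d} (\<lambda>y. (y - (c + d) / 2) * g x y)"
  assumes int: "(\<lambda>x. (x - (a + b) / 2) * w x) integrable_on {a..b}"
    and g: "\<And>x y. x \<in> {a..b} \<Longrightarrow> y \<in> {c..d} \<Longrightarrow> \<bar>g x y\<bar> \<le> k + l *
        (\<phi> x * \<psi> y * A\<^sub>1 + \<phi> x * (1 - \<psi> y) * A\<^sub>2 + (1 - \<phi> x) * \<psi> y * A\<^sub>3 + (1 - \<phi> x) * (1 - \<psi> y) * A\<^sub>4)"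
  defines "B \<equiv> hh_coeff p\<^sub>1" and "C \<equiv> hh_coeff p\<^sub>2"
  shows "\<bar>integral {a..b} (\<lambda>x. (x - (a + b) / 2) * w x)\<bar> \<le> (b - a)\<^sup>2 / 2 * ((d - c)\<^sup>2 / 2) *
      (k / 4 + l * (B * C * A\<^sub>1 + B * (1 / 2 - C) * A\<^sub>2 + (1 / 2 - B) * C * A\<^sub>3 + (1 / 2 - B) * (1 / 2 - C) * A\<^sub>4))"
proof -
  define \<alpha> where "\<alpha> = (d - c)\<^sup>2 / 2 * ((k + l * A\<^sub>4) / 2 + l * (A\<^sub>3 - A\<^sub>4) * C)"
  define \<beta> where "\<beta> = (d - c)\<^sup>2 / 2 * (l * (A\<^sub>2 - A\<^sub>4) / 2 + l * (A\<^sub>1 - A\<^sub>2 - A\<^sub>3 + A\<^sub>4) * C)"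
  have w_le: "\<bar>w x\<bar> \<le> \<alpha> + \<beta> * \<phi> x" if x: "x \<in> {a..b}" for x
  proof -
    define \<alpha>' where "\<alpha>' = k + l * (A\<^sub>2 * \<phi> x + A\<^sub>4 * (1 - \<phi> x))"
    define \<beta>' where "\<beta>' = l * (A\<^sub>1 * \<phi> x + A\<^sub>3 * (1 - \<phi> x) - A\<^sub>2 * \<phi> x - A\<^sub>4 * (1 - \<phi> x))"
    have I: "((\<lambda>y. \<bar>y - (c + d) / 2\<bar> * (\<alpha>' + \<beta>' * \<psi> y)) has_integral \<alpha> + \<beta> * \<phi> x) {c..d}"
    proof -
      have "(d - c)\<^sup>2 / 2 * (\<alpha>' / 2 + \<beta>' * C) = \<alpha> + \<beta> * \<phi> x"
        unfolding \<alpha>_def \<beta>_def \<alpha>'_def \<beta>'_def by (simp add: algebra_simps add_divide_distrib diff_divide_distrib)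
      then show ?thesis
        using has_integral_rpow_affine_weighted[OF cd p(2), of \<alpha>' \<beta>']
        unfolding \<psi>_def C_def by (simp only:)
    qed
    have le: "norm ((y - (c + d) / 2) * g x y) \<le> \<bar>y - (c + d) / 2\<bar> * (\<alpha>' + \<beta>' * \<psi> y)"
      if y: "y \<in> {c..d}" for y
    proof -
      have "\<bar>g x y\<bar> \<le> \<alpha>' + \<beta>' * \<psi> y"
        using g[OF x y] by (simp add: \<alpha>'_def \<beta>'_def algebra_simps)
      then show ?thesis by (simp add: abs_mult mult_left_mono)
    qed
    show ?thesis
    proof (cases "(\<lambda>y. (y - (c + d) / 2) * g x y) integrable_on {c..d}")
      case True
      then have "norm (w x) \<le> integral {c..d} (\<lambda>y. \<bar>y - (c + d) / 2\<bar> * (\<alpha>' + \<beta>' * \<psi> y))"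
        unfolding w_def using I le by (intro Henstock_Kurzweil_Integration.integral_norm_bound_integral) auto
      then show ?thesis using I by (simp add: integral_unique)
    next
      case False
      moreover have "0 \<le> \<alpha> + \<beta> * \<phi> x"
        using I by (rule has_integral_nonneg) (use le norm_ge_zero order_trans in blast)
      ultimately show ?thesis by (simp add: w_def not_integrable_integral)
    qed
  qed
  have I: "((\<lambda>x. \<bar>x - (a + b) / 2\<bar> * (\<alpha> + \<beta> * \<phi> x)) has_integral
      (b - a)\<^sup>2 / 2 * (\<alpha> / 2 + \<beta> * B)) {a..b}"
    unfolding \<phi>_def B_def by (rule has_integral_rpow_affine_weighted[OF ab p(1)])
  have "norm (integral {a..b} (\<lambda>x. (x - (a + b) / 2) * w x))
      \<le> integral {a..b} (\<lambda>x. \<bar>x - (a + b) / 2\<bar> * (\<alpha> + \<beta> * \<phi> x))"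
    using int I w_le
    by (intro Henstock_Kurzweil_Integration.integral_norm_bound_integral) (auto simp: abs_mult intro: mult_left_mono)
  also have "\<dots> = (b - a)\<^sup>2 / 2 * (\<alpha> / 2 + \<beta> * B)"
    using I by (rule integral_unique)
  also have "\<alpha> / 2 + \<beta> * B = (d - c)\<^sup>2 / 2 *
      (k / 4 + l * (B * C * A\<^sub>1 + B * (1 / 2 - C) * A\<^sub>2 + (1 / 2 - B) * C * A\<^sub>3 + (1 / 2 - B) * (1 / 2 - C) * A\<^sub>4))"
    unfolding \<alpha>_def \<beta>_def by (simp add: algebra_simps add_divide_distrib diff_divide_distrib)
  finally show ?thesis by simp
qed

theorem theorem5:
  fixes a b c d s\<^sub>1 s\<^sub>2 \<alpha>\<^sub>1 \<alpha>\<^sub>2 m\<^sub>1 m\<^sub>2 q :: real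
    and I J :: "real set"
    and f f\<^sub>x f\<^sub>y f\<^sub>x\<^sub>y :: "real \<Rightarrow> real \<Rightarrow> real"
  defines "B \<equiv> hh_coeff (\<alpha>\<^sub>1 * s\<^sub>1)"
    and "C \<equiv> hh_coeff (\<alpha>\<^sub>2 * s\<^sub>2)"
  assumes "a < b" and "c < d"
    and "s\<^sub>1 \<in> {0<..1}" and "s\<^sub>2 \<in> {0<..1}"
    and "\<alpha>\<^sub>1 \<in> {0..1}" and "\<alpha>\<^sub>2 \<in> {0..1}"
    and "m\<^sub>1 \<in> {0<..1}" and "m\<^sub>2 \<in> {0<..1}"
    and "q \<ge> 1"
    and "is_interval I" and "is_interval J"
    and "{a..b} \<subseteq> I" and "{c..d} \<subseteq> J"
    and "\<And>x. x \<in> {a..b} \<Longrightarrow> x / m\<^sub>1 \<in> I"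
    and "\<And>y. y \<in> {c..d} \<Longrightarrow> y / m\<^sub>2 \<in> J"
    and "\<And>x y. x \<in> I \<Longrightarrow> y \<in> J \<Longrightarrow>
           ((\<lambda>t. f t y) has_real_derivative f\<^sub>x x y) (at x within I)"
    and "\<And>x y. x \<in> I \<Longrightarrow> y \<in> J \<Longrightarrow>
           ((\<lambda>t. f x t) has_real_derivative f\<^sub>y x y) (at y within J)"
    and "\<And>x y. x \<in> I \<Longrightarrow> y \<in> J \<Longrightarrow>
           ((\<lambda>t. f\<^sub>y t y) has_real_derivative f\<^sub>x\<^sub>y x y) (at x within I)"
    and "(\<lambda>(x, y). f\<^sub>x\<^sub>y x y) absolutely_integrable_on {a..b} \<times> {c..d}"
    and "(\<lambda>x y. \<bar>f\<^sub>x\<^sub>y x y\<bar> powr q) \<in> K_class \<alpha>\<^sub>1 \<alpha>\<^sub>2 s\<^sub>1 s\<^sub>2 m\<^sub>1 m\<^sub>2 a b c d"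
  shows "\<bar>(f a c + f a d + f b c + f b d) / 4
          + 1 / ((b - a) * (d - c)) * integral {a..b} (\<lambda>x. integral {c..d} (\<lambda>y. f x y))
          - boundary_mean a b c d f\<bar>
        \<le> (b - a) * (d - c) / 4 powr ((2 * q - 1) / q)
          * (B * C * (\<bar>f\<^sub>x\<^sub>y a c\<bar> powr q + m\<^sub>1 * \<bar>f\<^sub>x\<^sub>y (b / m\<^sub>1) c\<bar> powr q)
             + (1 - B) * (1 - C)
               * (m\<^sub>2 * \<bar>f\<^sub>x\<^sub>y a (d / m\<^sub>2)\<bar> powr q
                  + m\<^sub>1 * m\<^sub>2 * \<bar>f\<^sub>x\<^sub>y (b / m\<^sub>1) (d / m\<^sub>2)\<bar> powr q)) powr (1 / q)"
proof -
  note ab = \<open>a < b\<close> and cd = \<open>c < d\<close> and q = \<open>q \<ge> 1\<close>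
  note sub = \<open>{a..b} \<subseteq> I\<close> \<open>{c..d} \<subseteq> J\<close>
  note fx = assms(18) and fy = assms(19) and fxy = assms(20)
    and int = assms(21) and K = assms(22)
  define p\<^sub>1 where "p\<^sub>1 = \<alpha>\<^sub>1 * s\<^sub>1"
  define p\<^sub>2 where "p\<^sub>2 = \<alpha>\<^sub>2 * s\<^sub>2"
  have p: "0 \<le> p\<^sub>1" "p\<^sub>1 \<le> 1" "0 \<le> p\<^sub>2" "p\<^sub>2 \<le> 1"
    using assms(5-8) by (auto simp: p\<^sub>1_def p\<^sub>2_def intro: mult_le_one)
  have m: "m\<^sub>1 > 0" "m\<^sub>2 > 0" using assms(9,10) by auto
  define \<phi> where "\<phi> x = rpow ((b - x) / (b - a)) p\<^sub>1" for x
  define \<psi> where "\<psi> y = rpow ((d - y) / (d - c)) p\<^sub>2" for y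
  define A\<^sub>1 where "A\<^sub>1 = \<bar>f\<^sub>x\<^sub>y a c\<bar> powr q"
  define A\<^sub>2 where "A\<^sub>2 = m\<^sub>2 * \<bar>f\<^sub>x\<^sub>y a (d / m\<^sub>2)\<bar> powr q"
  define A\<^sub>3 where "A\<^sub>3 = m\<^sub>1 * \<bar>f\<^sub>x\<^sub>y (b / m\<^sub>1) c\<bar> powr q"
  define A\<^sub>4 where "A\<^sub>4 = m\<^sub>1 * m\<^sub>2 * \<bar>f\<^sub>x\<^sub>y (b / m\<^sub>1) (d / m\<^sub>2)\<bar> powr q"
  have A: "A\<^sub>1 \<ge> 0" "A\<^sub>2 \<ge> 0" "A\<^sub>3 \<ge> 0" "A\<^sub>4 \<ge> 0"
    using m by (simp_all add: A\<^sub>1_def A\<^sub>2_def A\<^sub>3_def A\<^sub>4_def)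
  define R where "R x y = \<phi> x * \<psi> y * A\<^sub>1 + \<phi> x * (1 - \<psi> y) * A\<^sub>2 + (1 - \<phi> x) * \<psi> y * A\<^sub>3
      + (1 - \<phi> x) * (1 - \<psi> y) * A\<^sub>4" for x y
  have fxy_R: "\<bar>f\<^sub>x\<^sub>y x y\<bar> powr q \<le> R x y" if x: "x \<in> {a..b}" and y: "y \<in> {c..d}" for x y
  proof -
    define u where "u = (b - x) / (b - a)"
    define v where "v = (d - y) / (d - c)"
    have uv: "u \<in> {0..1}" "v \<in> {0..1}" using x y ab cd by (auto simp: u_def v_def)
    have xu: "u * a + (1 - u) * b = x" and yv: "v * c + (1 - v) * d = y"
    proof -
      have "u * (b - a) = b - x" "v * (d - c) = d - y" using ab cd by (simp_all add: u_def v_def)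
      then show "u * a + (1 - u) * b = x" "v * c + (1 - v) * d = y" by (simp_all add: algebra_simps)
    qed
    have corners: "a \<in> {a..b}" "b \<in> {a..b}" "c \<in> {c..d}" "d \<in> {c..d}" using ab cd by auto
    have conv: "\<forall>x\<in>{a..b}. \<forall>z\<in>{a..b}. \<forall>y\<in>{c..d}. \<forall>w\<in>{c..d}. \<forall>u\<in>{0..1}. \<forall>v\<in>{0..1}.
      \<bar>f\<^sub>x\<^sub>y (u * x + (1 - u) * z) (v * y + (1 - v) * w)\<bar> powr q
        \<le> rpow u p\<^sub>1 * rpow v p\<^sub>2 * \<bar>f\<^sub>x\<^sub>y x y\<bar> powr q
          + m\<^sub>2 * rpow u p\<^sub>1 * (1 - rpow v p\<^sub>2) * \<bar>f\<^sub>x\<^sub>y x (w / m\<^sub>2)\<bar> powr q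
          + m\<^sub>1 * rpow v p\<^sub>2 * (1 - rpow u p\<^sub>1) * \<bar>f\<^sub>x\<^sub>y (z / m\<^sub>1) y\<bar> powr q
          + m\<^sub>1 * m\<^sub>2 * (1 - rpow u p\<^sub>1) * (1 - rpow v p\<^sub>2) * \<bar>f\<^sub>x\<^sub>y (z / m\<^sub>1) (w / m\<^sub>2)\<bar> powr q"
      using K unfolding K_class_def p\<^sub>1_def p\<^sub>2_def by (rule CollectD)
    have "\<bar>f\<^sub>x\<^sub>y (u * a + (1 - u) * b) (v * c + (1 - v) * d)\<bar> powr q
        \<le> rpow u p\<^sub>1 * rpow v p\<^sub>2 * \<bar>f\<^sub>x\<^sub>y a c\<bar> powr q
          + m\<^sub>2 * rpow u p\<^sub>1 * (1 - rpow v p\<^sub>2) * \<bar>f\<^sub>x\<^sub>y a (d / m\<^sub>2)\<bar> powr q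
          + m\<^sub>1 * rpow v p\<^sub>2 * (1 - rpow u p\<^sub>1) * \<bar>f\<^sub>x\<^sub>y (b / m\<^sub>1) c\<bar> powr q
          + m\<^sub>1 * m\<^sub>2 * (1 - rpow u p\<^sub>1) * (1 - rpow v p\<^sub>2) * \<bar>f\<^sub>x\<^sub>y (b / m\<^sub>1) (d / m\<^sub>2)\<bar> powr q"
      by (rule conv[rule_format]) (use corners uv in auto)
    also have "\<dots> = R x y"
      by (simp only: R_def \<phi>_def \<psi>_def u_def v_def A\<^sub>1_def A\<^sub>2_def A\<^sub>3_def A\<^sub>4_def mult_ac)
    finally show ?thesis by (simp only: xu yv)
  qed
  have R_le: "R x y \<le> A\<^sub>1 + A\<^sub>2 + A\<^sub>3 + A\<^sub>4" if x: "x \<in> {a..b}" and y: "y \<in> {c..d}" for x y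
  proof -
    have b: "0 \<le> \<phi> x" "\<phi> x \<le> 1" "0 \<le> \<psi> y" "\<psi> y \<le> 1"
      using x y ab cd p unfolding \<phi>_def \<psi>_def by (auto intro!: rpow_bounds)
    have "R x y \<le> 1 * A\<^sub>1 + 1 * A\<^sub>2 + 1 * A\<^sub>3 + 1 * A\<^sub>4"
      unfolding R_def using b A by (intro add_mono mult_right_mono mult_le_one) auto
    then show ?thesis by simp
  qed
  \<comment> \<open>Any tangent gives boundedness; this one touches at \<open>K = 1\<close>.\<close>
  have bounded: "\<bar>f\<^sub>x\<^sub>y x y\<bar> \<le> 1 + 1 / q * (A\<^sub>1 + A\<^sub>2 + A\<^sub>3 + A\<^sub>4 - 1)"
    if x: "x \<in> {a..b}" and y: "y \<in> {c..d}" for x y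
  proof -
    have "\<bar>f\<^sub>x\<^sub>y x y\<bar> powr q \<le> A\<^sub>1 + A\<^sub>2 + A\<^sub>3 + A\<^sub>4"
      using fxy_R[OF x y] R_le[OF x y] by linarith
    then show ?thesis using powr_tangent_bound[OF q, of 1 "\<bar>f\<^sub>x\<^sub>y x y\<bar>"] by simp
  qed
  define T where "T = (f a c + f a d + f b c + f b d) / 4
          + 1 / ((b - a) * (d - c)) * integral {a..b} (\<lambda>x. integral {c..d} (\<lambda>y. f x y))
          - boundary_mean a b c d f"
  define w where "w x = integral {c..d} (\<lambda>y. (y - (c + d) / 2) * f\<^sub>x\<^sub>y x y)" for x
  have cont: "continuous_on {a..b} (\<lambda>x. f x y)" if "y \<in> {c..d}" for y
    using DERIV_continuous_on[of I "\<lambda>x. f x y" "\<lambda>x. f\<^sub>x x y"] fx that sub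
    by (blast intro: continuous_on_subset)
  have fy': "(f x has_real_derivative f\<^sub>y x y) (at y within {c..d})"
    if "x \<in> {a..b}" "y \<in> {c..d}" for x y
    using fy[of x y] that sub by (blast intro: DERIV_subset)
  have fxy': "((\<lambda>t. f\<^sub>y t y) has_real_derivative f\<^sub>x\<^sub>y x y) (at x within {a..b})"
    if "x \<in> {a..b}" "y \<in> {c..d}" for x y
    using fxy[of x y] that sub by (blast intro: DERIV_subset)
  note identity = trapezoid_defect_identity[OF ab cd cont fy' fxy' int bounded, folded w_def T_def]
  define S where "S = B * C * (A\<^sub>1 + A\<^sub>3) + (1 - B) * (1 - C) * (A\<^sub>2 + A\<^sub>4)"
  have BC: "1 / 4 \<le> B" "B \<le> 1 / 2" "1 / 4 \<le> C" "C \<le> 1 / 2"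
    using hh_coeff_bounds p by (auto simp: B_def C_def p\<^sub>1_def p\<^sub>2_def)
  have S0: "S \<ge> 0"
    unfolding S_def using BC A by (intro add_nonneg_nonneg mult_nonneg_nonneg) auto
  have S_ge: "B * C * A\<^sub>1 + B * (1 / 2 - C) * A\<^sub>2 + (1 / 2 - B) * C * A\<^sub>3 + (1 / 2 - B) * (1 / 2 - C) * A\<^sub>4 \<le> S"
  proof -
    have "B * (1 / 2 - C) * A\<^sub>2 \<le> (1 - B) * (1 - C) * A\<^sub>2"
      "(1 / 2 - B) * C * A\<^sub>3 \<le> B * C * A\<^sub>3"
      "(1 / 2 - B) * (1 / 2 - C) * A\<^sub>4 \<le> (1 - B) * (1 - C) * A\<^sub>4"
      using BC A by (intro mult_right_mono mult_mono; simp)+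
    then show ?thesis by (simp add: S_def algebra_simps)
  qed
  \<comment> \<open>The weights have total mass \<open>((b - a) * (d - c))\<^sup>2 / 16\<close>, so the mean of \<open>R\<close> is at most \<open>4 * S\<close>. 
    The tangent is taken at a larger \<open>k\<close>, since \<open>S\<close> may vanish; afterwards \<open>k\<close> tends to \<open>4 * S\<close>.\<close>
  have T_le: "\<bar>T\<bar> \<le> (b - a) * (d - c) / 16 * k powr (1 / q)" if k: "k > 4 * S" for k
  proof -
    define l where "l = k powr (1 / q - 1) / q"
    have k0: "k > 0" using k S0 by linarith
    have l0: "l \<ge> 0" using q by (simp add: l_def)
    have g: "\<bar>f\<^sub>x\<^sub>y x y\<bar> \<le> (k powr (1 / q) - l * k) + l * R x y"
      if "x \<in> {a..b}" "y \<in> {c..d}" for x y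
      using powr_tangent_bound[OF q k0 abs_ge_zero fxy_R[OF that]]
      unfolding l_def right_diff_distrib by linarith
    have "\<bar>(b - a) * (d - c) * T\<bar> \<le> (b - a)\<^sup>2 / 2 * ((d - c)\<^sup>2 / 2) * ((k powr (1 / q) - l * k) / 4
        + l * (B * C * A\<^sub>1 + B * (1 / 2 - C) * A\<^sub>2 + (1 / 2 - B) * C * A\<^sub>3 + (1 / 2 - B) * (1 / 2 - C) * A\<^sub>4))"
      using iterated_midpoint_moment_bound[OF ab cd p(1,3), of f\<^sub>x\<^sub>y "k powr (1 / q) - l * k" l A\<^sub>1 A\<^sub>2 A\<^sub>3 A\<^sub>4]
        identity g
      unfolding w_def R_def \<phi>_def \<psi>_def B_def C_def p\<^sub>1_def p\<^sub>2_def by simp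
    also have "\<dots> \<le> (b - a)\<^sup>2 / 2 * ((d - c)\<^sup>2 / 2) * (k powr (1 / q) / 4)"
    proof (rule mult_left_mono)
      have "l * (B * C * A\<^sub>1 + B * (1 / 2 - C) * A\<^sub>2 + (1 / 2 - B) * C * A\<^sub>3 + (1 / 2 - B) * (1 / 2 - C) * A\<^sub>4) \<le> l * (k / 4)"
        using l0 S_ge k by (intro mult_left_mono) linarith+
      then show "(k powr (1 / q) - l * k) / 4
        + l * (B * C * A\<^sub>1 + B * (1 / 2 - C) * A\<^sub>2 + (1 / 2 - B) * C * A\<^sub>3 + (1 / 2 - B) * (1 / 2 - C) * A\<^sub>4)
        \<le> k powr (1 / q) / 4" by (simp add: diff_divide_distrib)
    qed simp
    also have "\<dots> = ((b - a) * (d - c)) * ((b - a) * (d - c) / 16 * k powr (1 / q))"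
      by (simp add: power2_eq_square)
    finally show ?thesis
      using ab cd by (simp add: abs_mult)
  qed
  have "\<bar>T\<bar> \<le> (b - a) * (d - c) / 16 * (4 * S) powr (1 / q)"
  proof (rule tendsto_lowerbound)
    show "((\<lambda>k. (b - a) * (d - c) / 16 * k powr (1 / q)) \<longlongrightarrow> (b - a) * (d - c) / 16 * (4 * S) powr (1 / q))
        (at_right (4 * S))"
      using S0 q
      by (intro tendsto_mult_left tendsto_powr' tendsto_ident_at tendsto_const)
         (auto simp: eventually_at_filter)
    show "\<forall>\<^sub>F k in at_right (4 * S). \<bar>T\<bar> \<le> (b - a) * (d - c) / 16 * k powr (1 / q)"
      using T_le by (auto simp: eventually_at_filter)
  qed simp
  also have "\<dots> = (b - a) * (d - c) / 4 powr ((2 * q - 1) / q) * S powr (1 / q)"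
  proof -
    have "(2 * q - 1) / q = 2 - 1 / q" using q by (simp add: diff_divide_distrib)
    then have "4 powr ((2 * q - 1) / q) = 16 / 4 powr (1 / q)"
      by (simp add: powr_diff)
    then show ?thesis using S0 by (simp add: powr_mult)
  qed
  finally show ?thesis
    by (simp only: T_def S_def A\<^sub>1_def A\<^sub>2_def A\<^sub>3_def A\<^sub>4_def)
qed

end
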